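(* The $4$-dimensional complex Lie algebra $\mathfrak{sl}(2,\mathbb{C})\oplus\mathbb{C}$ has no metric Leibniz deformation.
   Context: All algebras are over $\mathbb{C}$. A left (resp. right) Leibniz algebra is a vector space $\mathfrak{L}$ with a bilinear bracket satisfying $[x,[y,z]]=[[x,y],z]+[y,[x,z]]$ (resp. $[x,[y,z]]=[[x,y],z]-[[x,z],y]$); a Leibniz algebra is one or the other. Lie algebras are Leibniz algebras. A bilinear form $B$ on $\mathfrak{L}$ is invariant if $B([x,y],z)=B(x,[y,z])$ for all $x,y,z$. $\mathfrak{L}$ is metric if it has a non-degenerate symmetric invariant bilinear form. A (formal $1$-parameter, Leibniz) deformation of $(\mathfrak{L},\mu_0)$ is a Leibniz bracket $\mu_t=\mu_0+t\phi_1+t^2\phi_2+\cdots$ on $\mathfrak{L}\otimes\mathbb{C}[[t]]$, with $\phi_i$ bilinear maps $\mathfrak{L}\times\mathfrak{L}\to\mathfrak{L}$. Two deformations $\mu_t,\tilde\mu_t$ are equivalent if $\tilde\mu_t(x,y)=\Phi_t\mu_t(\Phi_t^{-1}x,\Phi_t^{-1}y)$ for some $\Phi_t=\mathrm{id}+t\,\Phi_1+t^2\Phi_2+\cdots$ with linear $\Phi_i$; a deformation equivalent to $\mu_0$ is trivial. A metric deformation is a non-trivial deformation $\mu_t$ that is a metric Leibniz algebra for $t\neq 0$ (for formal $t$: after extending scalars to $\mathbb{C}((t))$). Here $\mathfrak{sl}(2,\mathbb{C})$ has basis $e_1,e_2,e_3$ with $[e_1,e_2]=e_3$, $[e_2,e_3]=2e_2$,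 $[e_1,e_3]=-2e_1$ (extended skew-symmetrically), and $\mathbb{C}$ is the $1$-dimensional abelian algebra. *)

theory Defs
  imports
    "HOL-Analysis.Analysis"
    "HOL-Computational_Algebra.Formal_Laurent_Series"
begin

section \<open>Leibniz algebras over a commutative ring\<close>

text \<open>
  The ground ring varies (complex numbers, power series, Laurent series), so an algebra is given by
  a scalar multiplication \<open>s\<close> on the carrier type together with a bracket \<open>m\<close>.
\<close>

definition module_bilinear ::
  "('r::comm_ring_1 \<Rightarrow> 'v::ab_group_add \<Rightarrow> 'v) \<Rightarrow> ('r \<Rightarrow> 'w::ab_group_add \<Rightarrow> 'w) \<Rightarrow>
   ('v \<Rightarrow> 'v \<Rightarrow> 'w) \<Rightarrow> bool" where
  "module_bilinear s s' f \<longleftrightarrow>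
     (\<forall>x. module_hom s s' (\<lambda>y. f x y)) \<and> (\<forall>y. module_hom s s' (\<lambda>x. f x y))"

definition left_leibniz ::
  "('r::comm_ring_1 \<Rightarrow> 'v::ab_group_add \<Rightarrow> 'v) \<Rightarrow> ('v \<Rightarrow> 'v \<Rightarrow> 'v) \<Rightarrow> bool" where
  "left_leibniz s m \<longleftrightarrow> module_bilinear s s m \<and>
     (\<forall>x y z. m x (m y z) = m (m x y) z + m y (m x z))"

definition right_leibniz ::
  "('r::comm_ring_1 \<Rightarrow> 'v::ab_group_add \<Rightarrow> 'v) \<Rightarrow> ('v \<Rightarrow> 'v \<Rightarrow> 'v) \<Rightarrow> bool" where
  "right_leibniz s m \<longleftrightarrow> module_bilinear s s m \<and>
     (\<forall>x y z. m x (m y z) = m (m x y) z - m (m x z) y)"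

definition leibniz_algebra ::
  "('r::comm_ring_1 \<Rightarrow> 'v::ab_group_add \<Rightarrow> 'v) \<Rightarrow> ('v \<Rightarrow> 'v \<Rightarrow> 'v) \<Rightarrow> bool" where
  "leibniz_algebra s m \<longleftrightarrow> left_leibniz s m \<or> right_leibniz s m"

definition invariant_form :: "('v \<Rightarrow> 'v \<Rightarrow> 'v) \<Rightarrow> ('v \<Rightarrow> 'v \<Rightarrow> 'r) \<Rightarrow> bool" where
  "invariant_form m B \<longleftrightarrow> (\<forall>x y z. B (m x y) z = B x (m y z))"

definition symmetric_form :: "('v \<Rightarrow> 'v \<Rightarrow> 'r) \<Rightarrow> bool" where
  "symmetric_form B \<longleftrightarrow> (\<forall>x y. B x y = B y x)"

text \<open>Only used for symmetric forms over a field, so one side suffices.\<close>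

definition nondegenerate_form :: "('v::zero \<Rightarrow> 'v \<Rightarrow> 'r::zero) \<Rightarrow> bool" where
  "nondegenerate_form B \<longleftrightarrow> (\<forall>x. (\<forall>y. B x y = 0) \<longrightarrow> x = 0)"

definition metric_leibniz_algebra ::
  "('k::field \<Rightarrow> 'v::ab_group_add \<Rightarrow> 'v) \<Rightarrow> ('v \<Rightarrow> 'v \<Rightarrow> 'v) \<Rightarrow> bool" where
  "metric_leibniz_algebra s m \<longleftrightarrow> leibniz_algebra s m \<and>
     (\<exists>B. module_bilinear s (*) B \<and> symmetric_form B \<and> nondegenerate_form B \<and> invariant_form m B)"


section \<open>Formal deformations\<close>

text \<open>
  For the vector space \<open>complex ^ 'n\<close>, the extensions of scalars to formal power series and to formal
  Laurent series are \<open>complex fps ^ 'n\<close> and \<open>complex fls ^ 'n\<close>, with scalar multiplication \<open>(*s)\<close>.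
  An element \<open>x\<close> of \<open>complex fps ^ 'n\<close> is the series \<open>\<Sum>k. t^k *s vec_coeff x k\<close>.
\<close>

definition vec_coeff :: "'a fps ^ 'n \<Rightarrow> nat \<Rightarrow> 'a ^ 'n" where
  "vec_coeff x k = (\<chi> i. fps_nth (x $ i) k)"

definition vec_series :: "(nat \<Rightarrow> 'a ^ 'n) \<Rightarrow> 'a fps ^ 'n" where
  "vec_series a = (\<chi> i. Abs_fps (\<lambda>k. a k $ i))"

text \<open>
  \<open>formal_linear \<psi>\<close> is \<open>\<psi> 0 + t \<psi> 1 + t\<^sup>2 \<psi> 2 + \<dots>\<close> and \<open>formal_bilinear \<phi>\<close> is
  \<open>\<phi> 0 + t \<phi> 1 + t\<^sup>2 \<phi> 2 + \<dots>\<close>, both extended linearly over the power series ring.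
\<close>

definition formal_linear ::
  "(nat \<Rightarrow> complex ^ 'n \<Rightarrow> complex ^ 'n) \<Rightarrow> complex fps ^ 'n \<Rightarrow> complex fps ^ 'n" where
  "formal_linear \<psi> x = vec_series (\<lambda>k. \<Sum>i\<le>k. \<psi> i (vec_coeff x (k - i)))"

definition formal_bilinear ::
  "(nat \<Rightarrow> complex ^ 'n \<Rightarrow> complex ^ 'n \<Rightarrow> complex ^ 'n) \<Rightarrow>
   complex fps ^ 'n \<Rightarrow> complex fps ^ 'n \<Rightarrow> complex fps ^ 'n" where
  "formal_bilinear \<phi> x y =
     vec_series (\<lambda>k. \<Sum>i\<le>k. \<Sum>j\<le>k - i. \<phi> i (vec_coeff x j) (vec_coeff y (k - i - j)))"

definition leibniz_deformation ::
  "(complex ^ 'n \<Rightarrow> complex ^ 'n \<Rightarrow> complex ^ 'n) \<Rightarrow>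
   (complex fps ^ 'n \<Rightarrow> complex fps ^ 'n \<Rightarrow> complex fps ^ 'n) \<Rightarrow> bool" where
  "leibniz_deformation \<mu> M \<longleftrightarrow>
     (\<exists>\<phi>. \<phi> 0 = \<mu> \<and> (\<forall>i. module_bilinear (*s) (*s) (\<phi> i)) \<and> M = formal_bilinear \<phi>) \<and>
     leibniz_algebra (*s) M"

text \<open>
  \<open>formal_linear \<psi>\<close> is a bijection whenever \<open>\<psi> 0 = id\<close> and all \<open>\<psi> i\<close> are linear, so \<open>inv\<close> is its
  actual inverse.
\<close>

definition equivalent_deformations ::
  "(complex fps ^ 'n \<Rightarrow> complex fps ^ 'n \<Rightarrow> complex fps ^ 'n) \<Rightarrow>
   (complex fps ^ 'n \<Rightarrow> complex fps ^ 'n \<Rightarrow> complex fps ^ 'n) \<Rightarrow> bool" where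
  "equivalent_deformations M M' \<longleftrightarrow>
     (\<exists>\<psi> \<Phi>. \<psi> 0 = id \<and> (\<forall>i. module_hom (*s) (*s) (\<psi> i)) \<and> \<Phi> = formal_linear \<psi> \<and>
        (\<forall>x y. M' x y = \<Phi> (M (inv \<Phi> x) (inv \<Phi> y))))"

definition constant_deformation ::
  "(complex ^ 'n \<Rightarrow> complex ^ 'n \<Rightarrow> complex ^ 'n) \<Rightarrow>
   complex fps ^ 'n \<Rightarrow> complex fps ^ 'n \<Rightarrow> complex fps ^ 'n" where
  "constant_deformation \<mu> = formal_bilinear (\<lambda>i. if i = 0 then \<mu> else (\<lambda>x y. 0))"

definition trivial_deformation ::
  "(complex ^ 'n \<Rightarrow> complex ^ 'n \<Rightarrow> complex ^ 'n) \<Rightarrow>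
   (complex fps ^ 'n \<Rightarrow> complex fps ^ 'n \<Rightarrow> complex fps ^ 'n) \<Rightarrow> bool" where
  "trivial_deformation \<mu> M \<longleftrightarrow> equivalent_deformations M (constant_deformation \<mu>)"

text \<open>
  Extension of scalars from power series to Laurent series: the bilinear map over the Laurent series
  which takes the same values as \<open>M\<close> on the standard basis.
\<close>

definition laurent_extension ::
  "(complex fps ^ 'n \<Rightarrow> complex fps ^ 'n \<Rightarrow> complex fps ^ 'n) \<Rightarrow>
   complex fls ^ 'n \<Rightarrow> complex fls ^ 'n \<Rightarrow> complex fls ^ 'n" where
  "laurent_extension M x y =
     (\<Sum>i\<in>UNIV. \<Sum>j\<in>UNIV. (x $ i * y $ j) *s (\<chi> k. fps_to_fls (M (axis i 1) (axis j 1) $ k)))"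

definition metric_deformation ::
  "(complex ^ 'n \<Rightarrow> complex ^ 'n \<Rightarrow> complex ^ 'n) \<Rightarrow>
   (complex fps ^ 'n \<Rightarrow> complex fps ^ 'n \<Rightarrow> complex fps ^ 'n) \<Rightarrow> bool" where
  "metric_deformation \<mu> M \<longleftrightarrow> leibniz_deformation \<mu> M \<and> \<not> trivial_deformation \<mu> M \<and>
     metric_leibniz_algebra (*s) (laurent_extension M)"


section \<open>The algebra\<close>

text \<open>Coordinates are taken with respect to the basis \<open>e\<^sub>i = axis i 1\<close>, \<open>i = 1, 2, 3\<close>.\<close>

definition sl2_bracket :: "complex ^ 3 \<Rightarrow> complex ^ 3 \<Rightarrow> complex ^ 3" where
  "sl2_bracket x y = vector
     [-2 * (x $ 1 * y $ 3 - x $ 3 * y $ 1),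
       2 * (x $ 2 * y $ 3 - x $ 3 * y $ 2),
       x $ 1 * y $ 2 - x $ 2 * y $ 1]"

lemma sl2_bracket_basis:
  "sl2_bracket (axis 1 1) (axis 2 1) = axis 3 1"
  "sl2_bracket (axis 2 1) (axis 3 1) = 2 *s axis 2 1"
  "sl2_bracket (axis 1 1) (axis 3 1) = (-2) *s axis 1 1"
  by (simp_all add: sl2_bracket_def vec_eq_iff forall_3 axis_def)

lemma sl2_bracket_skew: "sl2_bracket x y = - sl2_bracket y x"
  by (simp add: sl2_bracket_def vec_eq_iff forall_3 algebra_simps)

definition abelian_bracket :: "complex ^ 'n \<Rightarrow> complex ^ 'n \<Rightarrow> complex ^ 'n" where
  "abelian_bracket x y = 0"

text \<open>The direct sum of \<open>complex ^ 'm\<close> and \<open>complex ^ 'n\<close> is realised as \<open>complex ^ ('m + 'n)\<close>.\<close>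

definition direct_sum_bracket ::
  "(complex ^ 'm \<Rightarrow> complex ^ 'm \<Rightarrow> complex ^ 'm) \<Rightarrow>
   (complex ^ 'n \<Rightarrow> complex ^ 'n \<Rightarrow> complex ^ 'n) \<Rightarrow>
   complex ^ ('m + 'n) \<Rightarrow> complex ^ ('m + 'n) \<Rightarrow> complex ^ ('m + 'n)" where
  "direct_sum_bracket \<mu> \<nu> x y = (\<chi> k. case k of
       Inl i \<Rightarrow> \<mu> (\<chi> i. x $ Inl i) (\<chi> i. y $ Inl i) $ i
     | Inr j \<Rightarrow> \<nu> (\<chi> j. x $ Inr j) (\<chi> j. y $ Inr j) $ j)"

definition sl2_plus_C :: "complex ^ (3 + 1) \<Rightarrow> complex ^ (3 + 1) \<Rightarrow> complex ^ (3 + 1)" where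
  "sl2_plus_C = direct_sum_bracket sl2_bracket abelian_bracket"

end

theory Submission
  imports Defs
begin

text \<open>
  Write \<open>R\<close> for the power series ring. Clearing denominators, the form becomes an \<open>R\<close>-valued
  nondegenerate invariant form \<open>b\<close> for a bracket on \<open>R\<^sup>4\<close> that reduces to \<open>sl(2) \<oplus> C\<close> modulo \<open>t\<close>.
  Invariance makes the bracket both left and right Leibniz, so all squares are central. There is
  a nonzero central element: if all squares vanish, \<open>b(xy, w)\<close> is an alternating \<open>3\<close>-form in
  dimension \<open>4\<close>, and such a form has a kernel. After removing powers of \<open>t\<close>, a central \<open>z\<close> reduces
  to a multiple of \<open>e\<^sub>4\<close>. The functional \<open>b(z, \<cdot>)\<close> kills all products; made primitive, it reduces to a
  multiple of the fourth coordinate, so it is nonzero on every primitive central element. Hence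
  the squares vanish, and the bracket is a Lie bracket which splits as the kernel of the functional
  plus the line through \<open>z\<close>. The kernel is a deformation of \<open>sl(2)\<close>, and it is brought to standard
  form by diagonalising the adjoint map of a lift of \<open>e\<^sub>3\<close>. So the deformation is trivial.
\<close>

unbundle no Formal_Power_Series.fps_syntax

section \<open>Vectors of power series and formal maps\<close>

lemma vec_coeff_add [simp]: "vec_coeff (x + y) k = vec_coeff x k + vec_coeff y k"
  for x y :: "'a::comm_ring_1 fps ^ 'n"
  by (simp add: vec_coeff_def vec_eq_iff)

lemma vec_coeff_diff [simp]: "vec_coeff (x - y) k = vec_coeff x k - vec_coeff y k"
  for x y :: "'a::comm_ring_1 fps ^ 'n"
  by (simp add: vec_coeff_def vec_eq_iff)

lemma vec_coeff_zero [simp]: "vec_coeff (0 :: 'a::comm_ring_1 fps ^ 'n) k = 0"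
  by (simp add: vec_coeff_def vec_eq_iff)

lemma vec_coeff_0_smult [simp]: "vec_coeff (a *s x) 0 = fps_nth a 0 *s vec_coeff x 0"
  for x :: "'a::comm_ring_1 fps ^ 'n"
  by (simp add: vec_coeff_def vec_eq_iff)

lemma vec_coeff_vec_series [simp]: "vec_coeff (vec_series a) k = a k"
  by (simp add: vec_coeff_def vec_series_def)

lemma vec_eqI_coeff: "(\<And>k. vec_coeff x k = vec_coeff y k) \<Longrightarrow> x = y"
  by (simp add: vec_coeff_def vec_eq_iff fps_eq_iff)

text \<open>The exponent is the order of vanishing at t = 0; dividing by this power of t leaves a
  vector that is nonzero modulo t.\<close>

lemma fps_vec_primitive_part:
  fixes x :: "'a::idom fps ^ 'n"
  assumes "x \<noteq> 0"
  obtains k x' where "x = fps_X ^ k *s x'" "vec_coeff x' 0 \<noteq> 0"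
proof -
  define k where "k = (LEAST k. vec_coeff x k \<noteq> 0)"
  have "\<exists>k. vec_coeff x k \<noteq> 0"
    using assms vec_eqI_coeff[of x 0] by auto
  then have k: "vec_coeff x k \<noteq> 0"
    unfolding k_def by (rule LeastI_ex)
  have less: "vec_coeff x j = 0" if "j < k" for j
    using not_less_Least[OF that[unfolded k_def]] by simp
  have 0: "fps_nth (x $ i) j = 0" if "j < k" for i j
    using less[OF that] by (simp add: vec_coeff_def vec_eq_iff)
  define x' where "x' = (\<chi> i. fps_shift k (x $ i))"
  have "x = fps_X ^ k *s x'"
    by (auto simp: vec_eq_iff x'_def fps_eq_iff fps_X_power_mult_nth 0)
  moreover have "vec_coeff x' 0 \<noteq> 0"
    using k by (simp add: vec_coeff_def x'_def vec_eq_iff)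
  ultimately show thesis using that by blast
qed

lemma module_smult_vec: "module ((*s) :: 'a::comm_ring_1 \<Rightarrow> 'a ^ 'n \<Rightarrow> 'a ^ 'n)"
  by unfold_locales (auto simp: vec_eq_iff algebra_simps)

lemma module_hom_smultI:
  fixes f :: "'a::comm_ring_1 ^ 'n \<Rightarrow> 'a ^ 'm"
  assumes "\<And>x y. f (x + y) = f x + f y" "\<And>c x. f (c *s x) = c *s f x"
  shows "module_hom (*s) (*s) f"
  using assms by (simp add: module_hom_def module_hom_axioms_def module_smult_vec)

lemma module_hom_vec_expansion:
  fixes f :: "'a::comm_ring_1 ^ 'n \<Rightarrow> 'w::ab_group_add"
  assumes "module_hom (*s) s f"
  shows "f x = (\<Sum>i\<in>UNIV. s (x $ i) (f (axis i 1)))"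
proof -
  interpret module_hom "(*s)" s f by fact
  have "f x = f (\<Sum>i\<in>UNIV. x $ i *s axis i 1)" by (simp add: basis_expansion)
  then show ?thesis by (simp add: sum scale)
qed

section \<open>Linear maps over power series and their inverses\<close>

definition vec_const :: "'a::comm_ring_1 ^ 'n \<Rightarrow> 'a fps ^ 'n" where
  "vec_const v = (\<chi> i. fps_const (v $ i))"

lemma vec_coeff_0_const [simp]: "vec_coeff (vec_const v) 0 = v"
  by (simp add: vec_coeff_def vec_const_def)

text \<open>The component maps that present a map linear over power series in the form that
  \<open>equivalent_deformations\<close> demands.\<close>

definition linear_coeff where
  "linear_coeff G k v = vec_coeff (G (vec_const v)) k"

lemma module_hom_linear_coeff:
  fixes G :: "complex fps ^ 'n \<Rightarrow> complex fps ^ 'n"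
  assumes "module_hom (*s) (*s) G"
  shows "module_hom (*s) (*s) (linear_coeff G k)"
proof -
  interpret module_hom "(*s)" "(*s)" G by fact
  have "vec_const (x + y) = vec_const x + vec_const y" for x y :: "complex ^ 'n"
    by (simp add: vec_const_def vec_eq_iff)
  moreover have "vec_const (c *s x) = fps_const c *s vec_const x" for c and x :: "complex ^ 'n"
    by (simp add: vec_const_def vec_eq_iff)
  ultimately show ?thesis
    by (intro module_hom_smultI)
       (simp_all add: linear_coeff_def add scale, simp add: vec_coeff_def vec_eq_iff)
qed

lemma formal_linear_linear_coeff:
  fixes G :: "complex fps ^ 'n \<Rightarrow> complex fps ^ 'n"
  assumes "module_hom (*s) (*s) G"
  shows "formal_linear (linear_coeff G) = G"
proof (rule ext, rule vec_eqI_coeff)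
  fix x k
  note exp = module_hom_vec_expansion[OF assms]
  have "vec_coeff (G x) k = (\<Sum>j\<le>k. vec_coeff (G (vec_const (vec_coeff x (k - j)))) j)"
  proof (subst vec_eq_iff, rule allI)
    fix l
    have "vec_coeff (G x) k $ l = (\<Sum>i\<in>UNIV. fps_nth (G (axis i 1) $ l * x $ i) k)"
      by (subst exp) (simp add: vec_coeff_def fps_sum_nth mult.commute)
    also have "\<dots> = (\<Sum>j\<le>k. \<Sum>i\<in>UNIV. fps_nth (G (axis i 1) $ l) j * fps_nth (x $ i) (k - j))"
      by (subst sum.swap) (simp add: fps_mult_nth atLeast0AtMost)
    also have "\<dots> = (\<Sum>j\<le>k. vec_coeff (G (vec_const (vec_coeff x (k - j)))) j $ l)"
      by (subst (2) exp) (simp add: vec_coeff_def vec_const_def fps_sum_nth mult.commute)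
    finally show "vec_coeff (G x) k $ l
        = (\<Sum>j\<le>k. vec_coeff (G (vec_const (vec_coeff x (k - j)))) j) $ l"
      by simp
  qed
  then show "vec_coeff (formal_linear (linear_coeff G) x) k = vec_coeff (G x) k"
    by (simp add: formal_linear_def linear_coeff_def)
qed

text \<open>Solves for a preimage under \<open>formal_linear \<psi>\<close> degree by degree: when
  \<open>\<psi> 0\<close> is the identity, the equation in degree \<open>k\<close> isolates the
  \<open>k\<close>-th coefficient.\<close>

fun formal_preimage :: "(nat \<Rightarrow> complex ^ 'n \<Rightarrow> complex ^ 'n) \<Rightarrow> (nat \<Rightarrow> complex ^ 'n) \<Rightarrow> nat \<Rightarrow> complex ^ 'n" where
  "formal_preimage \<psi> b k = b k - (\<Sum>i\<in>{1..k}. \<psi> i (formal_preimage \<psi> b (k - i)))"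

declare formal_preimage.simps [simp del]

lemma surj_formal_linear:
  assumes "\<psi> 0 = id"
  shows "surj (formal_linear \<psi>)"
proof (rule surjI)
  fix y
  have "(\<Sum>i\<le>k. \<psi> i (formal_preimage \<psi> (vec_coeff y) (k - i))) = vec_coeff y k" for k
    by (subst atMost_atLeast0, subst sum.atLeast_Suc_atMost, simp, subst formal_preimage.simps)
       (simp add: assms)
  then show "formal_linear \<psi> (vec_series (formal_preimage \<psi> (vec_coeff y))) = y"
    by (intro vec_eqI_coeff) (simp add: formal_linear_def)
qed

text \<open>A nonzero kernel vector, divided by its power of t, would still be in the kernel but
  nonzero modulo t. Surjectivity is the degreewise recursion.\<close>

lemma bij_of_reduction_id:
  fixes G :: "complex fps ^ 'n \<Rightarrow> complex fps ^ 'n"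
  assumes lin: "module_hom (*s) (*s) G" and id: "\<And>x. vec_coeff (G x) 0 = vec_coeff x 0"
  shows "bij G"
proof (rule bijI)
  interpret module_hom "(*s)" "(*s)" G by fact
  show "inj G"
  proof (subst inj_iff_eq_0, intro allI impI)
    fix x assume "G x = 0"
    show "x = 0"
    proof (rule ccontr)
      assume "x \<noteq> 0"
      then obtain k x' where x: "x = fps_X ^ k *s x'" "vec_coeff x' 0 \<noteq> 0"
        by (rule fps_vec_primitive_part)
      with \<open>G x = 0\<close> have "G x' = 0" by (simp add: scale)
      with id[of x'] x(2) show False by simp
    qed
  qed
  have "linear_coeff G 0 = id" by (simp add: fun_eq_iff linear_coeff_def id)
  from surj_formal_linear[of "linear_coeff G", OF this] show "surj G"
    by (simp add: formal_linear_linear_coeff[OF lin])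
qed

text \<open>The equivalence runs from \<open>M\<close> to the constant bracket, so its map is
  \<open>inv G\<close>. The opposite direction \<open>G\<close> is the convenient one, since a
  choice of basis defines it.\<close>

lemma trivial_deformationI:
  fixes G :: "complex fps ^ 'n \<Rightarrow> complex fps ^ 'n"
  assumes lin: "module_hom (*s) (*s) G" and id: "\<And>x. vec_coeff (G x) 0 = vec_coeff x 0"
    and hom: "\<And>x y. M (G x) (G y) = G (constant_deformation \<mu> x y)"
  shows "trivial_deformation \<mu> M"
proof -
  interpret module_hom "(*s)" "(*s)" G by fact
  have bij: "bij G" by (rule bij_of_reduction_id[OF lin id])
  then have GF: "G (inv G x) = x" and FG: "inv G (G x) = x" for x
    by (simp_all add: bij_is_surj surj_f_inv_f bij_is_inj)
  have linF: "module_hom (*s) (*s) (inv G)"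
    by (rule module_hom_smultI) (metis GF FG add, metis GF FG scale)
  have "linear_coeff (inv G) 0 = id"
    by (rule ext) (simp add: linear_coeff_def id[of "inv G _", unfolded GF, symmetric])
  moreover have "constant_deformation \<mu> x y = inv G (M (inv (inv G) x) (inv (inv G) y))" for x y
    by (simp add: inv_inv_eq[OF bij] hom FG)
  ultimately show ?thesis
    unfolding trivial_deformation_def equivalent_deformations_def
    using module_hom_linear_coeff[OF linF] formal_linear_linear_coeff[OF linF, symmetric] by blast
qed

section \<open>Restricting a form to power series\<close>

lemma fls_common_denominator:
  fixes f :: "'i \<Rightarrow> complex fls"
  assumes "finite A"
  shows "\<exists>N g. \<forall>a\<in>A. fls_X ^ N * f a = fps_to_fls (g a)"
proof -
  define N where "N a = nat (- fls_subdegree (f a))" for a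
  define n where "n = (\<Sum>a\<in>A. N a)"
  have "fls_X ^ n * f a = fps_to_fls (fls_regpart (fls_X ^ n * f a))" if "a \<in> A" for a
  proof (cases "f a = 0")
    case False
    have "N a \<le> n" unfolding n_def using assms that by (intro member_le_sum) auto
    then have "0 \<le> fls_subdegree (fls_X ^ n * f a)"
      using False by (simp add: N_def)
    then show ?thesis by (rule fls_regpart_to_fls_trivial[symmetric])
  qed simp
  then show ?thesis by (intro exI[of _ n] exI[of _ "\<lambda>a. fls_regpart (fls_X ^ n * f a)"]) blast
qed

definition laurent_vec :: "complex fps ^ 'n \<Rightarrow> complex fls ^ 'n" where
  "laurent_vec x = (\<chi> i. fps_to_fls (x $ i))"

lemma fps_to_fls_sum: "fps_to_fls (\<Sum>i\<in>A. f i) = (\<Sum>i\<in>A. fps_to_fls (f i))"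
  by (induction A rule: infinite_finite_induct) simp_all

lemma module_bilinear_expansion:
  fixes f :: "'a::comm_ring_1 ^ 'n \<Rightarrow> 'a ^ 'm \<Rightarrow> 'w::ab_group_add"
  assumes "\<And>y. module_hom (*s) s (\<lambda>x. f x y)" "\<And>x. module_hom (*s) s (\<lambda>y. f x y)"
  shows "f x y = (\<Sum>i\<in>UNIV. \<Sum>j\<in>UNIV. s (x $ i) (s (y $ j) (f (axis i 1) (axis j 1))))"
proof -
  have "f x y = (\<Sum>i\<in>UNIV. s (x $ i) (f (axis i 1) y))"
    by (rule module_hom_vec_expansion[OF assms(1)])
  also have "\<dots> = (\<Sum>i\<in>UNIV. s (x $ i) (\<Sum>j\<in>UNIV. s (y $ j) (f (axis i 1) (axis j 1))))"
    by (subst module_hom_vec_expansion[OF assms(2)]) rule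
  also have "\<dots> = (\<Sum>i\<in>UNIV. \<Sum>j\<in>UNIV. s (x $ i) (s (y $ j) (f (axis i 1) (axis j 1))))"
    by (simp only: module.scale_sum_right[OF module_hom.axioms(2)[OF assms(1)]])
  finally show ?thesis .
qed

lemma laurent_extension_laurent_vec:
  assumes "module_bilinear (*s) (*s) M"
  shows "laurent_extension M (laurent_vec x) (laurent_vec y) = laurent_vec (M x y)"
proof -
  have "M x y = (\<Sum>i\<in>UNIV. \<Sum>j\<in>UNIV. x $ i *s (y $ j *s M (axis i 1) (axis j 1)))"
    using assms by (intro module_bilinear_expansion) (simp_all add: module_bilinear_def)
  then show ?thesis
    by (simp add: laurent_extension_def laurent_vec_def vec_eq_iff fps_to_fls_sum
        fls_times_fps_to_fls mult.assoc)
qed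

text \<open>A power of t clears the denominators of the Gram matrix. This factor is nonzero, so the
  form keeps its identities and its nondegeneracy.\<close>

lemma metric_leibniz_algebra_laurent_extensionD:
  fixes M :: "complex fps ^ 'n \<Rightarrow> complex fps ^ 'n \<Rightarrow> complex fps ^ 'n"
  assumes "module_bilinear (*s) (*s) M" "metric_leibniz_algebra (*s) (laurent_extension M)"
  obtains b :: "complex fps ^ 'n \<Rightarrow> complex fps ^ 'n \<Rightarrow> complex fps"
  where "module_bilinear (*s) (*) b" "symmetric_form b" "nondegenerate_form b" "invariant_form M b"
proof -
  obtain B where B: "module_bilinear (*s) (*) B" "symmetric_form B" "nondegenerate_form B"
    "invariant_form (laurent_extension M) B"
    using assms(2) unfolding metric_leibniz_algebra_def by blast
  have B_left: "module_hom (*s) (*) (\<lambda>x. B x y)" and B_right: "module_hom (*s) (*) (\<lambda>y. B x y)" for x y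
    using B(1) by (simp_all add: module_bilinear_def)
  obtain N g where g: "fls_X ^ N * B (axis i 1) (axis j 1) = fps_to_fls (g (i, j))" for i j
    using fls_common_denominator[of UNIV "\<lambda>(i, j). B (axis i 1) (axis j 1)"] by auto
  define b where "b x y = (\<Sum>i\<in>UNIV. \<Sum>j\<in>UNIV. x $ i * y $ j * g (i, j))" for x y
  have b: "fps_to_fls (b x y) = fls_X ^ N * B (laurent_vec x) (laurent_vec y)" for x y
    by (subst module_bilinear_expansion[OF B_left B_right])
       (simp add: b_def fps_to_fls_sum fls_times_fps_to_fls g[symmetric] laurent_vec_def
         sum_distrib_left mult_ac)
  have eq: "b x y = b x' y' \<longleftrightarrow> B (laurent_vec x) (laurent_vec y) = B (laurent_vec x') (laurent_vec y')"
    for x y x' y'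
    using b[of x y] b[of x' y'] by (metis fps_to_fls_eq_iff mult_cancel_left fls_X_nonzero power_not_zero)
  have mod: "module ((*) :: complex fps \<Rightarrow> _)"
    by unfold_locales (simp_all add: algebra_simps)
  show thesis
  proof (rule that[of b])
    show "module_bilinear (*s) (*) b"
      unfolding module_bilinear_def module_hom_def module_hom_axioms_def b_def
      by (simp add: module_smult_vec mod algebra_simps sum.distrib sum_distrib_left)
    show "symmetric_form b"
      using B(2) by (simp add: symmetric_form_def eq)
    show "invariant_form M b"
      using B(4) by (simp add: invariant_form_def eq flip: laurent_extension_laurent_vec[OF assms(1)])
    show "nondegenerate_form b"
      unfolding nondegenerate_form_def
    proof (intro allI impI)
      fix x assume x: "\<forall>y. b x y = 0"
      have "B (laurent_vec x) (axis j 1) = 0" for j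
      proof -
        have "laurent_vec (axis j 1) = axis j 1"
          by (simp add: laurent_vec_def vec_eq_iff axis_def)
        then show ?thesis using x b[of x "axis j 1"] by simp
      qed
      then have "B (laurent_vec x) y = 0" for y
        by (subst module_hom_vec_expansion[OF B_right]) simp
      then have "laurent_vec x = 0"
        using B(3) unfolding nondegenerate_form_def by blast
      then show "x = 0" by (simp add: laurent_vec_def vec_eq_iff)
    qed
  qed
qed


section \<open>Lie deformations of the split algebra\<close>

type_synonym 'a vec4 = "'a ^ (3 + 1)"

lemma UNIV_4: "(UNIV :: (3 + 1) set) = {Inl 1, Inl 2, Inl 3, Inr 1}"
proof -
  have "x \<in> {Inl 1, Inl 2, Inl 3, Inr 1}" for x :: "3 + 1"
  proof (cases x)
    case (Inl a)
    then show ?thesis using exhaust_3[of a] by auto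
  next
    case (Inr b)
    then show ?thesis by simp
  qed
  then show ?thesis by blast
qed

lemma sum_4: "(\<Sum>i\<in>UNIV. f i) = f (Inl 1) + f (Inl 2) + f (Inl 3) + f (Inr 1)"
  for f :: "3 + 1 \<Rightarrow> 'a::comm_monoid_add"
  by (simp add: UNIV_4 add.assoc)

lemma all_4: "(\<forall>i :: 3 + 1. P i) \<longleftrightarrow> P (Inl 1) \<and> P (Inl 2) \<and> P (Inl 3) \<and> P (Inr 1)"
  by (metis UNIV_4 UNIV_I insertE singletonD)

abbreviation "E1 \<equiv> axis (Inl 1) 1 :: complex vec4"
abbreviation "E2 \<equiv> axis (Inl 2) 1 :: complex vec4"
abbreviation "E3 \<equiv> axis (Inl 3) 1 :: complex vec4"
abbreviation "E4 \<equiv> axis (Inr 1) 1 :: complex vec4"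

lemma sl2_plus_C_nth [simp]:
  "sl2_plus_C x y $ Inl 1 = -2 * (x $ Inl 1 * y $ Inl 3 - x $ Inl 3 * y $ Inl 1)"
  "sl2_plus_C x y $ Inl 2 = 2 * (x $ Inl 2 * y $ Inl 3 - x $ Inl 3 * y $ Inl 2)"
  "sl2_plus_C x y $ Inl 3 = x $ Inl 1 * y $ Inl 2 - x $ Inl 2 * y $ Inl 1"
  "sl2_plus_C x y $ Inr 1 = 0"
  by (simp_all add: sl2_plus_C_def direct_sum_bracket_def sl2_bracket_def abelian_bracket_def)

lemma fps_nth_constant_deformation_sl2_plus_C:
  "fps_nth (constant_deformation sl2_plus_C x y $ i) k
     = (\<Sum>j\<le>k. sl2_plus_C (vec_coeff x j) (vec_coeff y (k - j)) $ i)"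
proof -
  have "vec_coeff (constant_deformation sl2_plus_C x y) k
      = (\<Sum>j\<le>k. sl2_plus_C (vec_coeff x j) (vec_coeff y (k - j)))"
    unfolding constant_deformation_def formal_bilinear_def vec_coeff_vec_series
    by (subst sum.atMost_shift) simp
  then have "vec_coeff (constant_deformation sl2_plus_C x y) k $ i
      = (\<Sum>j\<le>k. sl2_plus_C (vec_coeff x j) (vec_coeff y (k - j))) $ i"
    by simp
  then show ?thesis by (simp add: vec_coeff_def)
qed

lemma constant_deformation_sl2_plus_C_nth:
  fixes x y :: "complex fps vec4"
  defines "m \<equiv> constant_deformation sl2_plus_C x y"
  shows "m $ Inl 1 = -2 * (x $ Inl 1 * y $ Inl 3 - x $ Inl 3 * y $ Inl 1)"
    and "m $ Inl 2 = 2 * (x $ Inl 2 * y $ Inl 3 - x $ Inl 3 * y $ Inl 2)"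
    and "m $ Inl 3 = x $ Inl 1 * y $ Inl 2 - x $ Inl 2 * y $ Inl 1"
    and "m $ Inr 1 = 0"
proof -
  have coeff: "fps_nth (fps_const c * (a * b - a' * b')) k
      = (\<Sum>j\<le>k. c * (fps_nth a j * fps_nth b (k - j) - fps_nth a' j * fps_nth b' (k - j)))"
    for a b a' b' :: "complex fps" and c k
    by (simp add: fps_mult_nth[of a] fps_mult_nth[of a'] atLeast0AtMost
        flip: sum_distrib_left sum_subtractf)
  have "m $ Inl 1 = fps_const (-2) * (x $ Inl 1 * y $ Inl 3 - x $ Inl 3 * y $ Inl 1)"
    "m $ Inl 2 = fps_const 2 * (x $ Inl 2 * y $ Inl 3 - x $ Inl 3 * y $ Inl 2)"
    "m $ Inl 3 = fps_const 1 * (x $ Inl 1 * y $ Inl 2 - x $ Inl 2 * y $ Inl 1)"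
    unfolding fps_eq_iff coeff m_def fps_nth_constant_deformation_sl2_plus_C
    by (simp_all only: sl2_plus_C_nth) (simp_all add: vec_coeff_def)
  then show "m $ Inl 1 = -2 * (x $ Inl 1 * y $ Inl 3 - x $ Inl 3 * y $ Inl 1)"
    "m $ Inl 2 = 2 * (x $ Inl 2 * y $ Inl 3 - x $ Inl 3 * y $ Inl 2)"
    "m $ Inl 3 = x $ Inl 1 * y $ Inl 2 - x $ Inl 2 * y $ Inl 1"
    by (simp_all only: numeral_fps_const fps_const_1_eq_1 mult_1 flip: fps_const_neg)
  show "m $ Inr 1 = 0"
    by (simp add: fps_eq_iff m_def fps_nth_constant_deformation_sl2_plus_C)
qed

section \<open>Bases lifting the standard basis\<close>

definition combination ::
  "complex fps vec4 \<Rightarrow> complex fps vec4 \<Rightarrow> complex fps vec4 \<Rightarrow> complex fps vec4 \<Rightarrow>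
   complex fps vec4 \<Rightarrow> complex fps vec4" where
  "combination g1 g2 g3 g4 x =
     x $ Inl 1 *s g1 + x $ Inl 2 *s g2 + x $ Inl 3 *s g3 + x $ Inr 1 *s g4"

lemma module_hom_combination: "module_hom (*s) (*s) (combination g1 g2 g3 g4)"
  by (rule module_hom_smultI) (simp_all add: combination_def vec_eq_iff algebra_simps)

context
  fixes g1 g2 g3 g4 :: "complex fps vec4"
  assumes red: "vec_coeff g1 0 = E1" "vec_coeff g2 0 = E2" "vec_coeff g3 0 = E3" "vec_coeff g4 0 = E4"
begin

lemma vec_coeff_0_combination: "vec_coeff (combination g1 g2 g3 g4 x) 0 = vec_coeff x 0"
  by (simp add: combination_def red vec_eq_iff all_4 axis_def) (simp add: vec_coeff_def)

text \<open>An instance of Nakayama's lemma: vectors that reduce to a basis modulo t form a basis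
  over power series.\<close>

lemma bij_combination: "bij (combination g1 g2 g3 g4)"
  by (rule bij_of_reduction_id[OF module_hom_combination vec_coeff_0_combination])

lemma combination_coordinates:
  obtains a b c d where "x = a *s g1 + b *s g2 + c *s g3 + d *s g4"
proof -
  obtain y where "x = combination g1 g2 g3 g4 y"
    using surjD[OF bij_is_surj[OF bij_combination]] by blast
  then show thesis using that by (simp add: combination_def)
qed

lemma combination_independent:
  assumes "a *s g1 + b *s g2 + c *s g3 + d *s g4 = 0"
  shows "a = 0" "b = 0" "c = 0" "d = 0"
proof -
  define y :: "complex fps vec4" where
    "y = a *s axis (Inl 1) 1 + b *s axis (Inl 2) 1 + c *s axis (Inl 3) 1 + d *s axis (Inr 1) 1"
  have y: "y $ Inl 1 = a" "y $ Inl 2 = b" "y $ Inl 3 = c" "y $ Inr 1 = d"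
    by (simp_all add: y_def axis_def)
  have "combination g1 g2 g3 g4 y = combination g1 g2 g3 g4 0"
    using assms by (simp add: combination_def y)
  then have "y = 0"
    using bij_is_inj[OF bij_combination, THEN injD] by blast
  then show "a = 0" "b = 0" "c = 0" "d = 0"
    using y by auto
qed

end

section \<open>Normal form of a split Lie deformation\<close>

lemma fps_sqrt_exists:
  fixes a :: "complex fps"
  assumes "fps_nth a 0 = c\<^sup>2" "c \<noteq> 0"
  obtains s where "s\<^sup>2 = a" "fps_nth s 0 = c"
proof
  \<comment> \<open>The constant function \<open>c\<close> selects the branch of the root;
    \<open>Suc 1\<close> is its degree 2.\<close>
  define s where "s = fps_radical (\<lambda>_ _. c) (Suc 1) a"
  show "s\<^sup>2 = a"
    using power_radical[of a "\<lambda>_ _. c" 1] assms by (simp add: s_def numeral_2_eq_2)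
  show "fps_nth s 0 = c" by (simp add: s_def)
qed

text \<open>The name recalls that sl(2) + C is isomorphic to gl(2). Leibniz identities are assumed
  separately where they enter.\<close>

locale gl2_lift =
  fixes M :: "complex fps vec4 \<Rightarrow> complex fps vec4 \<Rightarrow> complex fps vec4"
  assumes bilinear: "module_bilinear (*s) (*s) M"
    and reduction: "vec_coeff (M x y) 0 = sl2_plus_C (vec_coeff x 0) (vec_coeff y 0)"
begin

lemma hom_left: "module_hom (*s) (*s) (\<lambda>x. M x y)"
  and hom_right: "module_hom (*s) (*s) (\<lambda>y. M x y)"
  using bilinear by (auto simp: module_bilinear_def)

lemmas M_simps [simp] =
  module_hom.add[OF hom_left] module_hom.add[OF hom_right]
  module_hom.diff[OF hom_left] module_hom.diff[OF hom_right]
  module_hom.neg[OF hom_left] module_hom.neg[OF hom_right]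
  module_hom.scale[OF hom_left] module_hom.scale[OF hom_right]
  module_hom.zero[OF hom_left] module_hom.zero[OF hom_right]

lemma skew_of_alternating:
  assumes "\<And>x. M x x = 0"
  shows "M x y = - M y x"
proof -
  have "M x y + M y x = M (x + y) (x + y) - M x x - M y y"
    by (simp only: M_simps) (simp add: algebra_simps)
  then show ?thesis
    unfolding assms by (simp add: eq_neg_iff_add_eq_0)
qed

text \<open>The four vectors form a basis with the structure constants of sl(2) + C, so sending the
  standard basis to them carries the constant bracket to \<open>M\<close>.\<close>

lemma trivial_deformation_of_basis:
  assumes alt: "\<And>x. M x x = 0"
    and red: "vec_coeff g1 0 = E1" "vec_coeff g2 0 = E2" "vec_coeff g3 0 = E3" "vec_coeff z 0 = E4"
    and zc: "\<And>x. M z x = 0"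
    and rel: "M g1 g2 = g3" "M g3 g1 = 2 *s g1" "M g3 g2 = (-2) *s g2"
  shows "trivial_deformation sl2_plus_C M"
proof -
  note skew = skew_of_alternating[OF alt]
  have zc': "M x z = 0" for x
    using skew[of x z] zc by simp
  show ?thesis
    by (rule trivial_deformationI[OF module_hom_combination vec_coeff_0_combination[OF red]])
       (simp add: combination_def constant_deformation_sl2_plus_C_nth alt zc zc' rel
          skew[of g2 g1] skew[of g1 g3] skew[of g2 g3], simp add: vec_eq_iff algebra_simps)
qed

lemma trivial_deformation_of_splitting:
  assumes alt: "\<And>x. M x x = 0"
    and jacobi: "\<And>x y w. M x (M y w) = M (M x y) w + M y (M x w)"
    and zc: "\<And>x. M z x = 0" and z0: "vec_coeff z 0 = E4"
    and lam: "module_hom (*s) (*) lam" and lam_M: "\<And>x y. lam (M x y) = 0" and lam_z: "lam z \<noteq> 0"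
  shows "trivial_deformation sl2_plus_C M"
proof -
  note skew = skew_of_alternating[OF alt]
  note lam_simps [simp] = module_hom.add[OF lam] module_hom.scale[OF lam]
  have minus_1: "fps_const (- 1) = (- 1 :: complex fps)"
    by (simp flip: fps_const_neg)
  \<comment> \<open>Products serve as lifts of e3, e1, e2 because \<open>lam\<close> kills them; 1/2
    and -1/2 cancel the eigenvalues 2 and -2 of the adjoint map of e3.\<close>
  define h where "h = M (vec_const E1) (vec_const E2)"
  define f1 where "f1 = fps_const (1/2) *s M h (vec_const E1)"
  define f2 where "f2 = fps_const (-1/2) *s M h (vec_const E2)"
  have h0: "vec_coeff h 0 = E3"
    by (simp add: h_def reduction vec_eq_iff all_4 axis_def)
  have f0: "vec_coeff f1 0 = E1" "vec_coeff f2 0 = E2"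
    by (simp_all add: f1_def f2_def reduction h0 vec_eq_iff all_4 axis_def)
  have lam0: "lam h = 0" "lam f1 = 0" "lam f2 = 0"
    by (simp_all add: h_def f1_def f2_def lam_M)
  have coords: "\<exists>a b c. x = a *s f1 + b *s f2 + c *s h" if "lam x = 0" for x
  proof -
    obtain a b c d where x: "x = a *s f1 + b *s f2 + c *s h + d *s z"
      using combination_coordinates[OF f0 h0 z0] by blast
    with that lam0 lam_z have "d = 0" by simp
    with x show ?thesis by auto
  qed
  obtain a b g where D1: "M h f1 = a *s f1 + b *s f2 + g *s h"
    using coords[OF lam_M] by blast
  obtain c a' g' where D2: "M h f2 = c *s f1 + a' *s f2 + g' *s h"
    using coords[OF lam_M] by blast
  obtain n1 n2 n3 where D3: "M f1 f2 = n1 *s f1 + n2 *s f2 + n3 *s h"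
    using coords[OF lam_M] by blast
  have r1: "vec_coeff (M h f1) 0 = 2 *s E1" and r2: "vec_coeff (M h f2) 0 = (-2) *s E2"
    and r3: "vec_coeff (M f1 f2) 0 = E3"
    by (simp_all add: reduction h0 f0 vec_eq_iff all_4 axis_def)
  have ab0: "fps_nth a 0 = 2" "fps_nth b 0 = 0" "fps_nth c 0 = 0"
    using r1 r2 unfolding D1 D2 by (simp_all add: f0 h0 vec_eq_iff all_4 axis_def)
  txt \<open>The Jacobi identity for \<open>h\<close>, \<open>f1\<close>, \<open>f2\<close> forces the adjoint map of \<open>h\<close> to have trace zero.\<close>
  have "a + a' = 0"
  proof -
    have "M h (M f1 f2) = n1 *s M h f1 + n2 *s M h f2"
      by (simp add: D3 alt)
    moreover have "M h (M f1 f2) = (a + a') *s M f1 f2 + g *s M h f2 - g' *s M h f1"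
    proof -
      have "M (M h f1) f2 = a *s M f1 f2 + g *s M h f2" by (simp add: D1 alt)
      moreover have "M f1 (M h f2) = a' *s M f1 f2 + g' *s M f1 h" by (simp add: D2 alt)
      ultimately show ?thesis
        unfolding jacobi[of h f1 f2] using skew[of f1 h] by (simp add: vec_eq_iff algebra_simps)
    qed
    \<comment> \<open>The vectors are rescaled to reduce to \<open>E1\<close>, \<open>E2\<close>,
      \<open>E3\<close>, \<open>E4\<close>, so they are independent and the third coefficient, the
      trace, vanishes.\<close>
    ultimately have "(-2 * (g' + n1)) *s (fps_const (1/2) *s M h f1) + (-2 * (g - n2)) *s (fps_const (-1/2) *s M h f2)
       + (a + a') *s M f1 f2 + 0 *s z = 0"
      by (simp add: vec_eq_iff algebra_simps numeral_fps_const minus_1)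
    then show ?thesis
      by (rule combination_independent(3)[rotated 4]) (simp_all add: r1 r2 r3 z0 vec_eq_iff all_4 axis_def)
  qed
  then have a': "a' = - a" by (simp add: eq_neg_iff_add_eq_0 add.commute)
  \<comment> \<open>Applying \<open>M h\<close> again kills the \<open>h\<close>-components
    \<open>g\<close> and \<open>g'\<close>, so the span of these images is stable under
    \<open>M h\<close>, with matrix entries \<open>a\<close>, \<open>b\<close>, \<open>c\<close>,
    \<open>- a\<close>.\<close>
  define D1 D2 where "D1 = M h f1" and "D2 = M h f2"
  have DD1: "M h D1 = a *s D1 + b *s D2" and DD2: "M h D2 = c *s D1 + (-a) *s D2"
    unfolding D1_def D2_def by (subst D1 D2, simp add: alt a')+
  have "fps_nth (a\<^sup>2 + b * c) 0 = 2\<^sup>2"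
    by (simp add: ab0 power2_eq_square)
  then obtain s where s: "s\<^sup>2 = a\<^sup>2 + b * c" and s0: "fps_nth s 0 = 2"
    by (rule fps_sqrt_exists) simp_all
  txt \<open>The adjoint map of \<open>h\<close> squares to \<open>s\<^sup>2\<close> on the span of \<open>D1\<close> and \<open>D2\<close>, so adding \<open>s\<close> to it or
    subtracting \<open>s\<close> from it gives eigenvectors for \<open>s\<close> and \<open>- s\<close>.\<close>
  define u1 u2 where "u1 = (a + s) *s D1 + b *s D2" and "u2 = c *s D1 - (a + s) *s D2"
  have s2: "s * (s * t) = a * (a * t) + b * (c * t)" for t
  proof -
    have "s * (s * t) = s\<^sup>2 * t" by (simp add: power2_eq_square mult.assoc)
    then show ?thesis unfolding s by (simp add: power2_eq_square distrib_right mult.assoc)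
  qed
  have hu1: "M h u1 = s *s u1" and hu2: "M h u2 = (- s) *s u2"
    by (simp_all add: u1_def u2_def DD1 DD2 vec_eq_iff algebra_simps s2)
  \<comment> \<open>Modulo t, \<open>a\<close> and \<open>s\<close> become 2, \<open>b\<close> and
    \<open>c\<close> vanish, and \<open>D1\<close>, \<open>D2\<close> become 2 e1 and -2 e2; hence
    the factor 8 = 4 * 2.\<close>
  have u0: "vec_coeff u1 0 = 8 *s E1" "vec_coeff u2 0 = 8 *s E2"
    by (simp_all add: u1_def u2_def D1_def D2_def r1 r2 ab0 s0 vec_eq_iff)
  obtain p q r where w: "M u1 u2 = p *s f1 + q *s f2 + r *s h"
    using coords[OF lam_M] by blast
  \<comment> \<open>\<open>M h\<close> is a derivation with weights \<open>s\<close> and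
    \<open>- s\<close> on the factors, so the product has weight zero and only its
    \<open>h\<close>-component survives.\<close>
  have "M h (M u1 u2) = 0"
    by (simp add: jacobi[of h] hu1 hu2 vector_smult_lneg)
  then have "(2 * p) *s (fps_const (1/2) *s D1) + (- 2 * q) *s (fps_const (-1/2) *s D2) + 0 *s h + 0 *s z = 0"
    by (simp add: w alt D1_def D2_def vec_eq_iff algebra_simps numeral_fps_const minus_1)
  note * = combination_independent(1,2)[OF _ _ h0 z0 this]
  have "p = 0" "q = 0"
    using * by (simp_all add: D1_def D2_def r1 r2 vec_eq_iff all_4 axis_def)
  with w have w: "M u1 u2 = r *s h" by simp
  have "vec_coeff (M u1 u2) 0 = 64 *s E3"
    by (simp add: reduction u0 vec_eq_iff all_4 axis_def)
  then have r0: "fps_nth r 0 = 64"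
    by (simp add: w h0 vec_eq_iff all_4 axis_def)
  define si ri where "si = inverse s" and "ri = inverse r"
  have inv: "s * si = 1" "r * ri = 1"
    using s0 r0 by (simp_all add: si_def ri_def inverse_mult_eq_1')
  have inv0: "fps_nth si 0 = 1 / 2" "fps_nth ri 0 = 1 / 64"
    using s0 r0 by (simp_all add: si_def ri_def inverse_eq_divide)
  show ?thesis
  proof (rule trivial_deformation_of_basis[OF alt _ _ _ z0 zc])
    \<comment> \<open>The factor 2/s turns the eigenvalues into 2 and -2, and 1/8 normalises
      \<open>u2\<close>. The factor 16/(s r) is then forced by the product of the first two vectors
      being the third.\<close>
    show "vec_coeff ((16 * (si * ri)) *s u1) 0 = E1" "vec_coeff (fps_const (1/8) *s u2) 0 = E2"
      "vec_coeff ((2 * si) *s h) 0 = E3"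
      by (simp_all add: inv0 u0 h0 vec_eq_iff)
    have const: "16 * fps_const (1 / 8) = (2 :: complex fps)"
      by (simp add: numeral_fps_const)
    have "M ((16 * (si * ri)) *s u1) (fps_const (1/8) *s u2) = (2 * (si * (r * ri))) *s h"
      by (simp add: w vector_smult_assoc const mult_ac)
    then show "M ((16 * (si * ri)) *s u1) (fps_const (1/8) *s u2) = (2 * si) *s h"
      by (simp add: inv)
    have "M ((2 * si) *s h) ((16 * (si * ri)) *s u1) = (2 * (s * si)) *s ((16 * (si * ri)) *s u1)"
      by (simp add: hu1 vec_eq_iff mult_ac)
    then show "M ((2 * si) *s h) ((16 * (si * ri)) *s u1) = 2 *s ((16 * (si * ri)) *s u1)"
      by (simp add: inv)
    have "M ((2 * si) *s h) (fps_const (1/8) *s u2) = (-2 * (s * si)) *s (fps_const (1/8) *s u2)"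
      by (simp add: hu2 vec_eq_iff mult_ac)
    then show "M ((2 * si) *s h) (fps_const (1/8) *s u2) = (-2) *s (fps_const (1/8) *s u2)"
      by (simp add: inv)
  qed
qed

end

section \<open>Metric Leibniz deformations\<close>

locale metric_gl2_lift = gl2_lift +
  fixes b :: "complex fps vec4 \<Rightarrow> complex fps vec4 \<Rightarrow> complex fps"
  assumes leibniz: "leibniz_algebra (*s) M"
    and b_bilinear: "module_bilinear (*s) (*) b"
    and b_symmetric: "symmetric_form b"
    and b_nondegenerate: "nondegenerate_form b"
    and b_invariant: "invariant_form M b"
begin

lemma b_hom_left: "module_hom (*s) (*) (\<lambda>x. b x y)"
  and b_hom_right: "module_hom (*s) (*) (\<lambda>y. b x y)"
  using b_bilinear by (auto simp: module_bilinear_def)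

lemmas b_simps [simp] =
  module_hom.add[OF b_hom_left] module_hom.add[OF b_hom_right]
  module_hom.diff[OF b_hom_left] module_hom.diff[OF b_hom_right]
  module_hom.neg[OF b_hom_left] module_hom.neg[OF b_hom_right]
  module_hom.scale[OF b_hom_left] module_hom.scale[OF b_hom_right]
  module_hom.zero[OF b_hom_left] module_hom.zero[OF b_hom_right]

lemma b_commute: "b x y = b y x"
  using b_symmetric by (simp add: symmetric_form_def)

lemma b_M: "b (M x y) w = b x (M y w)"
  using b_invariant by (simp add: invariant_form_def)

lemma b_eq_0I: "(\<And>y. b x y = 0) \<Longrightarrow> x = 0"
  using b_nondegenerate by (simp add: nondegenerate_form_def)

lemma b_eqI_left: "(\<And>w. b x w = b y w) \<Longrightarrow> x = y"
  using b_eq_0I[of "x - y"] by simp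

lemma b_eqI_right: "(\<And>w. b w x = b w y) \<Longrightarrow> x = y"
  using b_eqI_left[of x y] b_commute by metis

text \<open>Invariance makes left and right multiplication adjoint to each other, so passing to
  adjoints turns the left Leibniz identity into the right one and vice versa.\<close>
lemma
  shows left_identity: "M x (M y w) = M (M x y) w + M y (M x w)"
    and right_identity: "M x (M y w) = M (M x y) w - M (M x w) y"
proof -
  consider (left) "\<And>x y w. M x (M y w) = M (M x y) w + M y (M x w)"
    | (right) "\<And>x y w. M x (M y w) = M (M x y) w - M (M x w) y"
    using leibniz unfolding leibniz_algebra_def left_leibniz_def right_leibniz_def by blast
  then have "M x (M y w) = M (M x y) w + M y (M x w) \<and> M x (M y w) = M (M x y) w - M (M x w) y"
  proof cases
    case left
    have "M x (M y w) = M (M x y) w - M (M x w) y"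
    proof (rule b_eqI_left)
      fix v
      have "b x (M y (M w v)) = b x (M (M y w) v) + b x (M w (M y v))"
        by (simp only: left[of y w v] b_simps)
      then show "b (M x (M y w)) v = b (M (M x y) w - M (M x w) y) v"
        by (simp add: b_M)
    qed
    with left show ?thesis by blast
  next
    case right
    have "M x (M y w) = M (M x y) w + M y (M x w)"
    proof (rule b_eqI_right)
      fix v
      have "b (M v (M x y)) w = b (M (M v x) y) w - b (M (M v y) x) w"
        by (simp only: right[of v x y] b_simps)
      then show "b v (M x (M y w)) = b v (M (M x y) w + M y (M x w))"
        by (simp add: b_M)
    qed
    with right show ?thesis by blast
  qed
  then show "M x (M y w) = M (M x y) w + M y (M x w)" "M x (M y w) = M (M x y) w - M (M x w) y"
    by blast+
qed

section \<open>Central elements\<close>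

definition central :: "complex fps vec4 \<Rightarrow> bool" where
  "central z \<longleftrightarrow> (\<forall>x. M z x = 0 \<and> M x z = 0)"

text \<open>With equal arguments the left identity cancels to \<open>M (M x x) w = 0\<close> and the
  right one to \<open>M w (M x x) = 0\<close>.\<close>

lemma central_square: "central (M x x)"
  unfolding central_def using left_identity[of x x] right_identity[of _ x x] by simp

lemma exists_central: "\<exists>z. z \<noteq> 0 \<and> central z"
proof (cases "\<exists>x. M x x \<noteq> 0")
  case True
  then show ?thesis using central_square by blast
next
  case False
  then have alt: "M x x = 0" for x by simp
  note skew = skew_of_alternating[OF alt]
  \<comment> \<open>Symmetry and invariance rewrite both values as \<open>b (M x x) y\<close> and
    \<open>b x (M y y)\<close>.\<close>
  have rep: "b (M x y) x = 0" "b (M x y) y = 0" for x y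
    using b_commute[of "M x y" x] by (simp_all add: b_M alt) (simp add: alt flip: b_M)
  have skew12: "b (M x y) w = - b (M y x) w" for x y w
    by (subst skew) simp
  have skew23: "b (M x y) w = - b (M x w) y" for x y w
    unfolding b_M by (subst skew) simp
  have perms: "b (M y x) w = - b (M x y) w" "b (M x w) y = - b (M x y) w"
    "b (M w x) y = b (M x y) w" "b (M y w) x = b (M x y) w" "b (M w y) x = - b (M x y) w" for x y w
    using skew12[of y x w] skew23[of x w y] skew12[of w x y] skew23[of y w x] skew12[of w y x]
    by simp_all
  define F1 F2 F3 F4 where "F1 = vec_const E1" and "F2 = vec_const E2"
    and "F3 = vec_const E3" and "F4 = vec_const E4"
  have red: "vec_coeff F1 0 = E1" "vec_coeff F2 0 = E2" "vec_coeff F3 0 = E3" "vec_coeff F4 0 = E4"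
    by (simp_all add: F1_def F2_def F3_def F4_def)
  define T where "T x y w = b (M x y) w" for x y w
  txt \<open>In dimension \<open>4\<close> the \<open>3\<close>-form \<open>T\<close> is the contraction of a volume form with \<open>v\<close>.\<close>
  define v where "v = T F2 F3 F4 *s F1 + (- T F1 F3 F4) *s F2 + T F1 F2 F4 *s F3 + (- T F1 F2 F3) *s F4"
  have "b (M v y) w = 0" for y w
  proof -
    obtain p1 p2 p3 p4 where y: "y = p1 *s F1 + p2 *s F2 + p3 *s F3 + p4 *s F4"
      using combination_coordinates[OF red] by blast
    obtain q1 q2 q3 q4 where w: "w = q1 *s F1 + q2 *s F2 + q3 *s F3 + q4 *s F4"
      using combination_coordinates[OF red] by blast
    show ?thesis
      by (simp add: v_def y w alt rep T_def perms[where x = F1 and y = F2 and w = F3] perms[where x = F1 and y = F2 and w = F4]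
          perms[where x = F1 and y = F3 and w = F4] perms[where x = F2 and y = F3 and w = F4])
  qed
  then have "M v y = 0" for y by (intro b_eq_0I)
  then have "central v" unfolding central_def using skew[of _ v] by simp
  \<comment> \<open>Otherwise \<open>M F1 F2\<close> would be orthogonal to the whole basis, hence
    zero, although it reduces to e3.\<close>
  moreover have "v \<noteq> 0"
  proof
    assume "v = 0"
    then have T0: "T F1 F2 F3 = 0" "T F1 F2 F4 = 0"
      using combination_independent[OF red v_def[symmetric, unfolded \<open>v = 0\<close>]] by simp_all
    have "b (M F1 F2) w = 0" for w
    proof -
      obtain q1 q2 q3 q4 where w: "w = q1 *s F1 + q2 *s F2 + q3 *s F3 + q4 *s F4"
        using combination_coordinates[OF red] by blast
      show ?thesis using T0 by (simp add: w rep T_def)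
    qed
    then have "M F1 F2 = 0" by (intro b_eq_0I)
    then have "vec_coeff (M F1 F2) 0 = 0" by simp
    then have "sl2_plus_C E1 E2 = 0" by (simp add: reduction red)
    then show False by (simp add: vec_eq_iff all_4 axis_def)
  qed
  ultimately show ?thesis by blast
qed

text \<open>Power series have no t-torsion, so dividing by t keeps centrality. Brackets with e1 and
  e3 already force the first three coordinates of the reduction to vanish.\<close>

lemma central_primitive_part:
  assumes "central w" "w \<noteq> 0"
  obtains k z c where "w = fps_X ^ k *s z" "central z" "vec_coeff z 0 = c *s E4" "c \<noteq> 0"
proof -
  obtain k z where z: "w = fps_X ^ k *s z" "vec_coeff z 0 \<noteq> 0"
    using fps_vec_primitive_part[OF assms(2)] by blast
  have "fps_X ^ k *s M z x = 0" "fps_X ^ k *s M x z = 0" for x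
    using assms(1) unfolding central_def z(1) by simp_all
  then have "central z" by (simp add: central_def vec_eq_iff)
  then have "vec_coeff (M z x) 0 = 0" for x by (simp add: central_def)
  from this[of "vec_const E1"] this[of "vec_const E3"]
  have "vec_coeff z 0 = vec_coeff z 0 $ Inr 1 *s E4"
    by (simp add: reduction vec_eq_iff all_4 axis_def)
  moreover from this z(2) have "vec_coeff z 0 $ Inr 1 \<noteq> 0" by auto
  ultimately show thesis using that z(1) \<open>central z\<close> by blast
qed

lemma trivial: "trivial_deformation sl2_plus_C M"
proof -
  obtain z' c where z': "central z'" "vec_coeff z' 0 = c *s E4" "c \<noteq> 0"
    using exists_central central_primitive_part by metis
  define z where "z = fps_const (1 / c) *s z'"
  have z: "central z" "vec_coeff z 0 = E4"
    using z' by (simp_all add: z_def central_def vector_smult_assoc)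
  define l where "l = (\<chi> i. b z (axis i 1))"
  have bl: "b z x = (\<Sum>i\<in>UNIV. x $ i * l $ i)" for x
    by (subst module_hom_vec_expansion[OF b_hom_right]) (simp add: l_def)
  have "l \<noteq> 0"
  proof
    assume "l = 0"
    then have "z = 0" using bl by (intro b_eq_0I) simp
    with z(2) show False by (simp add: vec_eq_iff all_4 axis_def)
  qed
  \<comment> \<open>The form may degenerate modulo t, so the functional is divided by its power of t
    before reducing.\<close>
  then obtain k l' where l': "l = fps_X ^ k *s l'" "vec_coeff l' 0 \<noteq> 0"
    using fps_vec_primitive_part by blast
  define lam where "lam x = (\<Sum>i\<in>UNIV. x $ i * l' $ i)" for x
  have lam: "module_hom (*s) (*) lam"
    by (simp add: module_hom_def module_hom_axioms_def module_smult_vec lam_def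
        sum_4 algebra_simps) (unfold_locales; simp add: algebra_simps)
  have b_lam: "b z x = fps_X ^ k * lam x" for x
    by (simp add: bl l' lam_def sum_distrib_left mult_ac)
  have lam_M: "lam (M x y) = 0" for x y
  proof -
    have "b z (M x y) = 0" using z(1) by (simp add: central_def flip: b_M)
    then show ?thesis by (simp add: b_lam)
  qed
  have lam_0: "fps_nth (lam x) 0 = (\<Sum>i\<in>UNIV. vec_coeff x 0 $ i * vec_coeff l' 0 $ i)" for x
    by (simp add: lam_def fps_sum_nth vec_coeff_def)
  have "(\<Sum>i\<in>UNIV. sl2_plus_C x y $ i * vec_coeff l' 0 $ i) = 0" for x y
    using lam_0[of "M (vec_const x) (vec_const y)"] by (simp add: lam_M reduction)
  \<comment> \<open>These brackets are multiples of e3, e1, e2, so the reduced functional sees only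
    the fourth coordinate.\<close>
  from this[of E1 E2] this[of E1 E3] this[of E2 E3]
  have l'0: "vec_coeff l' 0 $ Inl 3 = 0" "vec_coeff l' 0 $ Inl 1 = 0" "vec_coeff l' 0 $ Inl 2 = 0"
    by (simp_all add: sum_4 axis_def)
  with l'(2) have l'4: "vec_coeff l' 0 $ Inr 1 \<noteq> 0" by (simp add: vec_eq_iff all_4)
  have lam_central: "lam x \<noteq> 0" if "vec_coeff x 0 = d *s E4" "d \<noteq> 0" for x d
  proof -
    have "fps_nth (lam x) 0 \<noteq> 0"
      unfolding lam_0 using that l'4 by (simp add: sum_4 l'0 axis_def)
    then show ?thesis by auto
  qed
  \<comment> \<open>A nonzero square is a power of t times a primitive central vector, on which
    \<open>lam\<close> is nonzero; yet \<open>lam\<close> kills every product.\<close>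
  have alt: "M x x = 0" for x
  proof (rule ccontr)
    assume "M x x \<noteq> 0"
    then obtain j y d where y: "M x x = fps_X ^ j *s y" "vec_coeff y 0 = d *s E4" "d \<noteq> 0"
      using central_primitive_part central_square by metis
    have "fps_X ^ j * lam y = 0"
      using lam_M[of x x] unfolding y(1) by (simp add: module_hom.scale[OF lam])
    then show False using lam_central[OF y(2,3)] by simp
  qed
  show ?thesis
  proof (rule trivial_deformation_of_splitting[OF alt left_identity _ z(2) lam lam_M])
    show "M z x = 0" for x using z(1) by (simp add: central_def)
    show "lam z \<noteq> 0" using lam_central[of z 1] z(2) by simp
  qed
qed

end

text \<open>In degree 0 the Cauchy sum has a single term, so a deformation reduces to the original
  bracket, as \<open>gl2_lift\<close> requires.\<close>

lemma vec_coeff_0_formal_bilinear: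
  "vec_coeff (formal_bilinear \<phi> x y) 0 = \<phi> 0 (vec_coeff x 0) (vec_coeff y 0)"
  by (simp add: formal_bilinear_def)

theorem proposition4p1:
  shows "\<not> (\<exists>M. metric_deformation sl2_plus_C M)"
proof
  assume "\<exists>M. metric_deformation sl2_plus_C M"
  then obtain M where def: "leibniz_deformation sl2_plus_C M"
    and nontrivial: "\<not> trivial_deformation sl2_plus_C M"
    and metric: "metric_leibniz_algebra (*s) (laurent_extension M)"
    unfolding metric_deformation_def by blast
  obtain \<phi> where \<phi>: "\<phi> 0 = sl2_plus_C" "M = formal_bilinear \<phi>" and leibniz: "leibniz_algebra (*s) M"
    using def unfolding leibniz_deformation_def by blast
  then have bil: "module_bilinear (*s) (*s) M"
    by (auto simp: leibniz_algebra_def left_leibniz_def right_leibniz_def)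
  obtain b where "module_bilinear (*s) (*) b" "symmetric_form b" "nondegenerate_form b"
    "invariant_form M b"
    using metric_leibniz_algebra_laurent_extensionD[OF bil metric] .
  then have "metric_gl2_lift M b"
    using bil leibniz
    by unfold_locales (simp_all add: \<phi> vec_coeff_0_formal_bilinear)
  then show False
    using nontrivial metric_gl2_lift.trivial by blast
qed

end
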